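(* Let $(X,\|\cdot\|)$ be a complex normed space and let $x,y\in X\setminus\{0\}$. Write $\angle(x,y)=\frac{\pi}{2}+a+ib\in\mathcal A$ with $a,b\in\mathbb R$, so that $-\frac{\pi}{2}\le a\le\frac{\pi}{2}$ (and if $a=\pm\frac{\pi}{2}$ then $b=0$, since $\angle(x,y)\in\mathcal A$). Then $$\angle(i x,y)=\frac{\pi}{2}+\frac12\Big[-\operatorname{sgn}(b)\cdot\arccos(H_-)+i\cdot\operatorname{sgn}(a)\cdot\operatorname{arcosh}(H_+)\Big],$$ where $$H_\pm:=\sqrt{\Big[\cos^2\!\big(\tfrac{\pi}{2}+a\big)+\cosh^2(b)-2\Big]^2+4\cos^2\!\big(\tfrac{\pi}{2}+a\big)\cosh^2(b)}\ \pm\ \Big[\cos^2\!\big(\tfrac{\pi}{2}+a\big)+\cosh^2(b)-1\Big].$$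
   Context: Let $(X,\|\cdot\|)$ be a complex normed vector space and let $i$ be the imaginary unit. The product $\langle\cdot\,|\,\cdot\rangle:X\times X\to\mathbb C$ is defined as follows: $\langle x|y\rangle:=0$ if $x=0$ or $y=0$, and otherwise $$\langle x|y\rangle:=\|x\|\,\|y\|\cdot\tfrac14\Big[\big\|\tfrac{x}{\|x\|}+\tfrac{y}{\|y\|}\big\|^2-\big\|\tfrac{x}{\|x\|}-\tfrac{y}{\|y\|}\big\|^2+i\Big(\big\|\tfrac{x}{\|x\|}+i\tfrac{y}{\|y\|}\big\|^2-\big\|\tfrac{x}{\|x\|}-i\tfrac{y}{\|y\|}\big\|^2\Big)\Big].$$ Let $\mathcal A:=\{a+ib\mid 0<a<\pi,\ b\in\mathbb R\}\cup\{0,\pi\}$ and $\mathcal B:=\mathbb C\setminus\{r\in\mathbb R\mid r<-1\text{ or }r>1\}$. The complex cosine restricts to a homeomorphism $\cos:\mathcal A\to\mathcal B$, and $\arccos:\mathcal B\to\mathcal A$ denotes its inverse. For $x,y\in X\setminus\{0\}$ the angle is the complex number $\angle(x,y):=\arccos\big(\langle x|y\rangle/(\|x\|\,\|y\|)\big)\in\mathcal A$ (the argument always lies in $\mathcal B$). In the formula for $\angle(ix,y)$, $\arccos:[-1,1]\to[0,\pi]$ is the real arccosine, $\operatorname{arcosh}(t)=\log(t+\sqrt{t^2-1})$ for real $t\ge1$, and $\operatorname{sgn}(0)=0$, $\operatorname{sgn}(t)=1$ for $t>0$, $\operatorname{sgn}(t)=-1$ for $t<0$. *)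

theory Defs
  imports "HOL-Analysis.Analysis"
begin

text \<open>The real structure underlying a complex normed space is the restriction of scalars,
  as required by \<open>scaleC_of_real\<close>; in particular \<open>scaleC 1 x = x\<close>.\<close>

class complex_normed_vector = real_normed_vector +
  fixes scaleC :: "complex \<Rightarrow> 'a \<Rightarrow> 'a"  (infixr "*\<^sub>C" 75)
  assumes scaleC_add_right: "c *\<^sub>C (x + y) = c *\<^sub>C x + c *\<^sub>C y"
    and scaleC_add_left: "(c + d) *\<^sub>C x = c *\<^sub>C x + d *\<^sub>C x"
    and scaleC_scaleC: "c *\<^sub>C (d *\<^sub>C x) = (c * d) *\<^sub>C x"
    and scaleC_of_real: "complex_of_real r *\<^sub>C x = r *\<^sub>R x"
    and norm_scaleC: "norm (c *\<^sub>C x) = cmod c * norm x"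

instantiation complex :: complex_normed_vector
begin
definition scaleC_complex :: "complex \<Rightarrow> complex \<Rightarrow> complex"
  where "scaleC_complex c z = c * z"
instance
  by standard (auto simp: scaleC_complex_def algebra_simps norm_mult scaleR_conv_of_real)
end

definition normed_product :: "'a::complex_normed_vector \<Rightarrow> 'a \<Rightarrow> complex" where
  "normed_product x y =
    (if x = 0 \<or> y = 0 then 0
     else let u = x /\<^sub>R norm x; v = y /\<^sub>R norm y in
       complex_of_real (norm x * norm y) * (1/4) *
         (complex_of_real ((norm (u + v))\<^sup>2 - (norm (u - v))\<^sup>2)
          + \<i> * complex_of_real ((norm (u + \<i> *\<^sub>C v))\<^sup>2 - (norm (u - \<i> *\<^sub>C v))\<^sup>2)))"

definition angle_range :: "complex set" where
  "angle_range = {z. 0 < Re z \<and> Re z < pi} \<union> {0, complex_of_real pi}"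

definition cos_range :: "complex set" where
  "cos_range = UNIV - {complex_of_real r | r. r < -1 \<or> r > 1}"

lemma bij_betw_cos_angle_range: "bij_betw cos angle_range cos_range"
  unfolding bij_betw_def
proof
  show "inj_on cos angle_range"
    by (rule inj_on_inverseI[where g = Arccos], rule Arccos_cos) (auto simp: angle_range_def)
  show "cos ` angle_range = cos_range"
  proof
    show "cos ` angle_range \<subseteq> cos_range"
    proof (rule image_subsetI)
      fix z assume z: "z \<in> angle_range"
      show "cos z \<in> cos_range"
      proof (rule ccontr)
        assume "cos z \<notin> cos_range"
        then obtain r where r: "cos z = complex_of_real r" "r < -1 \<or> r > 1"
          by (auto simp: cos_range_def)
        have "Im z = 0"
        proof (cases "0 < Re z \<and> Re z < pi")
          case True
          have "Im (cos z) = 0" using r by simp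
          then have "sin (Re z) * (exp (- Im z) - exp (Im z)) = 0" by (simp add: Im_cos)
          moreover have "sin (Re z) \<noteq> 0" using True sin_gt_zero by fastforce
          ultimately show ?thesis by simp
        qed (use z in \<open>auto simp: angle_range_def\<close>)
        then have "Re (cos z) = cos (Re z)" by (simp add: Re_cos)
        then show False using r cos_ge_minus_one[of "Re z"] cos_le_one[of "Re z"] by auto
      qed
    qed
    show "cos_range \<subseteq> cos ` angle_range"
    proof
      fix w assume w: "w \<in> cos_range"
      obtain z where z: "cos z = w" "0 \<le> Re z" "Re z \<le> pi"
      proof (cases "0 \<le> Re (Arccos w)")
        case True
        then show thesis using that[of "Arccos w"] Re_Arccos_bounds[of w] by auto
      next
        case False
        then show thesis using that[of "- Arccos w"] Re_Arccos_bounds[of w] by auto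
      qed
      show "w \<in> cos ` angle_range"
      proof (cases "0 < Re z \<and> Re z < pi")
        case True
        then show ?thesis using z(1) by (auto simp: angle_range_def)
      next
        case False
        then have "Re z = 0 \<or> Re z = pi" using z by auto
        then have "Im w = 0" and re: "\<bar>Re w\<bar> = cosh (Im z)"
          using z(1) exp_gt_zero[of "Im z"] exp_gt_zero[of "- Im z"]
          by (auto simp: Im_cos Re_cos cosh_def abs_if field_simps simp del: exp_gt_zero)
        then have "w = complex_of_real (Re w)" by (simp add: complex_eq_iff)
        with w have "\<not> (Re w < -1 \<or> Re w > 1)" by (auto simp: cos_range_def)
        with re cosh_real_ge_1[of "Im z"] have "Re w = 1 \<or> Re w = -1" by auto
        with \<open>w = complex_of_real (Re w)\<close> have "w = cos 0 \<or> w = cos (complex_of_real pi)"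
          by (auto simp: cos_of_real)
        then show ?thesis by (auto simp: angle_range_def)
      qed
    qed
  qed
qed

definition complex_arccos :: "complex \<Rightarrow> complex" where
  "complex_arccos = the_inv_into angle_range cos"

definition complex_angle :: "'a::complex_normed_vector \<Rightarrow> 'a \<Rightarrow> complex" where
  "complex_angle x y = complex_arccos (normed_product x y / complex_of_real (norm x * norm y))"

definition H_plus :: "real \<Rightarrow> real \<Rightarrow> real" where
  "H_plus a b =
    sqrt (((cos (pi/2 + a))\<^sup>2 + (cosh b)\<^sup>2 - 2)\<^sup>2 + 4 * (cos (pi/2 + a))\<^sup>2 * (cosh b)\<^sup>2)
    + ((cos (pi/2 + a))\<^sup>2 + (cosh b)\<^sup>2 - 1)"

definition H_minus :: "real \<Rightarrow> real \<Rightarrow> real" where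
  "H_minus a b =
    sqrt (((cos (pi/2 + a))\<^sup>2 + (cosh b)\<^sup>2 - 2)\<^sup>2 + 4 * (cos (pi/2 + a))\<^sup>2 * (cosh b)\<^sup>2)
    - ((cos (pi/2 + a))\<^sup>2 + (cosh b)\<^sup>2 - 1)"

end

theory Submission
  imports Defs
begin

text \<open>Replacing \<open>x\<close> by \<open>\<i> x\<close> multiplies the cosine of the angle by \<open>\<i>\<close>. Writing the two angles as
  \<open>\<pi>/2 + a + \<i>b\<close> and \<open>\<pi>/2 + c + \<i>d\<close>, this says \<open>sin c cosh d = - cos a sinh b\<close> and
  \<open>cos c sinh d = sin a cosh b\<close>. Squaring expresses the difference and the product of
  \<open>cosh (2d)\<close> and \<open>cos (2c)\<close> in terms of \<open>sin\<^sup>2 a\<close> and \<open>cosh\<^sup>2 b\<close>, which yields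
  \<open>cosh (2d) = H\<^sub>+\<close> and \<open>cos (2c) = H\<^sub>-\<close>; the signs of \<open>c\<close> and \<open>d\<close> are read off the two equations.\<close>

text \<open>Measured from the midpoint \<open>pi/2\<close> the strip is symmetric, and its two extra
  boundary points \<open>0\<close> and \<open>pi\<close> become the case
  \<open>\<bar>a\<bar> = pi/2\<close> with \<open>b = 0\<close>.\<close>

lemma shifted_mem_angle_range_iff:
  "complex_of_real (pi/2) + complex_of_real a + \<i> * complex_of_real b \<in> angle_range
    \<longleftrightarrow> \<bar>a\<bar> < pi/2 \<or> \<bar>a\<bar> = pi/2 \<and> b = 0"
  using pi_gt_zero by (simp add: angle_range_def complex_eq_iff del: pi_gt_zero) arith

lemma cos_shifted:
  "cos (complex_of_real (pi/2) + complex_of_real a + \<i> * complex_of_real b)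
    = - Complex (sin a * cosh b) (cos a * sinh b)"
proof -
  have "cos (pi/2 + a) = - sin a" "sin (pi/2 + a) = cos a"
    by (simp_all add: cos_add sin_add)
  then show ?thesis
    by (simp add: complex_eq_iff Re_cos Im_cos cosh_def sinh_def field_simps)
qed

lemma scaleC_minus_one: "(-1) *\<^sub>C x = - (x::'a::complex_normed_vector)"
  using scaleC_of_real[of "-1" x] by simp

lemma scaleC_i_i: "\<i> *\<^sub>C \<i> *\<^sub>C x = - (x::'a::complex_normed_vector)"
  by (simp add: scaleC_scaleC scaleC_minus_one)

lemma scaleC_diff_right:
  "c *\<^sub>C (x - y) = c *\<^sub>C x - c *\<^sub>C (y::'a::complex_normed_vector)"
  using scaleC_add_right[of c "x - y" y] by simp

lemma scaleC_scaleR: "c *\<^sub>C (r *\<^sub>R x) = r *\<^sub>R (c *\<^sub>C (x::'a::complex_normed_vector))"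
  by (simp flip: scaleC_of_real add: scaleC_scaleC mult.commute)

lemma norm_scaleC_i: "norm (\<i> *\<^sub>C x) = norm (x::'a::complex_normed_vector)"
  by (simp add: norm_scaleC)

text \<open>Multiplication by \<open>\<i>\<close> is isometric, and replacing \<open>u\<close> by
  \<open>\<i> *\<^sub>C u\<close> permutes the four vectors of the polarization formula up to a
  factor \<open>\<i>\<close>. The norms in the real part thus move to the imaginary part, and those
  in the imaginary part move back with the opposite sign.\<close>

lemma normed_product_scaleC_i:
  fixes x y :: "'a::complex_normed_vector"
  shows "normed_product (\<i> *\<^sub>C x) y = \<i> * normed_product x y"
proof (cases "x = 0 \<or> y = 0")
  case True
  have "\<i> *\<^sub>C x = 0" if "x = 0"
    using that norm_scaleC_i[of x] by simp
  with True show ?thesis by (auto simp: normed_product_def)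
next
  case False
  define u v where "u = x /\<^sub>R norm x" and "v = y /\<^sub>R norm y"
  have ix: "\<i> *\<^sub>C x \<noteq> 0" "\<i> *\<^sub>C x /\<^sub>R norm x = \<i> *\<^sub>C u"
    using False norm_scaleC_i[of x] by (auto simp: u_def scaleC_scaleR)
  have "\<i> *\<^sub>C u + v = \<i> *\<^sub>C (u - \<i> *\<^sub>C v)" "\<i> *\<^sub>C u - v = \<i> *\<^sub>C (u + \<i> *\<^sub>C v)"
    "\<i> *\<^sub>C u + \<i> *\<^sub>C v = \<i> *\<^sub>C (u + v)" "\<i> *\<^sub>C u - \<i> *\<^sub>C v = \<i> *\<^sub>C (u - v)"
    by (simp_all add: scaleC_diff_right scaleC_add_right scaleC_i_i)
  then have n: "norm (\<i> *\<^sub>C u + v) = norm (u - \<i> *\<^sub>C v)" "norm (\<i> *\<^sub>C u - v) = norm (u + \<i> *\<^sub>C v)"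
    "norm (\<i> *\<^sub>C u + \<i> *\<^sub>C v) = norm (u + v)" "norm (\<i> *\<^sub>C u - \<i> *\<^sub>C v) = norm (u - v)"
    by (simp_all add: norm_scaleC_i)
  show ?thesis
    using False ix(1)
    unfolding normed_product_def Let_def norm_scaleC_i ix(2) u_def[symmetric] v_def[symmetric] n
    by (simp add: algebra_simps complex_eq_iff)
qed

text \<open>For unit vectors both norms in the real part are at most 2, so the difference of their
  squares is at most 4 in absolute value. The points missing from \<open>cos_range\<close> are real
  with absolute value above 1, so a bound on the real part suffices.\<close>

lemma normed_product_mem_cos_range:
  fixes x y :: "'a::complex_normed_vector"
  assumes "x \<noteq> 0" "y \<noteq> 0"
  shows "normed_product x y / complex_of_real (norm x * norm y) \<in> cos_range"
proof -
  define u v where "u = x /\<^sub>R norm x" and "v = y /\<^sub>R norm y"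
  have unit: "norm u = 1" "norm v = 1"
    using assms by (auto simp: u_def v_def)
  then have "norm (u + v) \<le> 2" "norm (u - v) \<le> 2"
    using norm_triangle_ineq[of u v] norm_triangle_ineq4[of u v] by auto
  then have le: "(norm (u + v))\<^sup>2 \<le> 2\<^sup>2" "(norm (u - v))\<^sup>2 \<le> 2\<^sup>2"
    using power_mono[of "norm (u + v)" 2 2] power_mono[of "norm (u - v)" 2 2] by simp_all
  have "normed_product x y / complex_of_real (norm x * norm y) =
      1/4 * (complex_of_real ((norm (u + v))\<^sup>2 - (norm (u - v))\<^sup>2)
          + \<i> * complex_of_real ((norm (u + \<i> *\<^sub>C v))\<^sup>2 - (norm (u - \<i> *\<^sub>C v))\<^sup>2))"
    using assms unfolding normed_product_def Let_def u_def[symmetric] v_def[symmetric] by simp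
  then have "Re (normed_product x y / complex_of_real (norm x * norm y))
      = ((norm (u + v))\<^sup>2 - (norm (u - v))\<^sup>2) / 4"
    by (simp only:) simp
  moreover have "\<bar>((norm (u + v))\<^sup>2 - (norm (u - v))\<^sup>2) / 4\<bar> \<le> 1"
  proof -
    have "\<bar>(p - q) / 4\<bar> \<le> 1" if "0 \<le> p" "0 \<le> q" "p \<le> 2\<^sup>2" "q \<le> 2\<^sup>2" for p q :: real
      using that by (simp add: abs_le_iff)
    then show ?thesis
      using le by simp
  qed
  ultimately have re: "\<bar>Re (normed_product x y / complex_of_real (norm x * norm y))\<bar> \<le> 1"
    by metis
  have "w \<in> cos_range" if "\<bar>Re w\<bar> \<le> 1" for w
    using that by (auto simp: cos_range_def)
  with re show ?thesis by blast
qed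

text \<open>Inverting \<open>cos\<close> is meaningful only on \<open>cos_range\<close>, which
  contains the argument. These two facts determine the angle, and all later steps use it only
  through them.\<close>

lemma
  fixes x y :: "'a::complex_normed_vector"
  assumes "x \<noteq> 0" "y \<noteq> 0"
  shows complex_angle_mem: "complex_angle x y \<in> angle_range"
    and cos_complex_angle:
      "cos (complex_angle x y) = normed_product x y / complex_of_real (norm x * norm y)"
proof -
  note in_range = normed_product_mem_cos_range[OF assms]
  show "complex_angle x y \<in> angle_range"
    unfolding complex_angle_def complex_arccos_def
    using bij_betwE[OF bij_betw_the_inv_into[OF bij_betw_cos_angle_range]] in_range by blast
  show "cos (complex_angle x y) = normed_product x y / complex_of_real (norm x * norm y)"
    unfolding complex_angle_def complex_arccos_def
    by (rule f_the_inv_into_f_bij_betw[OF bij_betw_cos_angle_range]) (use in_range in blast)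
qed

lemma cos_complex_angle_scaleC_i:
  fixes x y :: "'a::complex_normed_vector"
  assumes "x \<noteq> 0" "y \<noteq> 0"
  shows "cos (complex_angle (\<i> *\<^sub>C x) y) = \<i> * cos (complex_angle x y)"
proof -
  have "\<i> *\<^sub>C x \<noteq> 0"
    using assms norm_scaleC_i[of x] by auto
  then show ?thesis
    using assms by (simp add: cos_complex_angle normed_product_scaleC_i norm_scaleC_i)
qed

lemma
  fixes a b c d :: real
  assumes re: "sin c * cosh d = - (cos a * sinh b)"
    and im: "cos c * sinh d = sin a * cosh b"
  shows H_plus_eq_cosh: "H_plus a b = cosh (2 * d)"
    and H_minus_eq_cos: "H_minus a b = cos (2 * c)"
proof -
  define S C where "S = (sin a)\<^sup>2" and "C = (cosh b)\<^sup>2"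
  define P Q where "P = cosh (2 * d)" and "Q = cos (2 * c)"
  have P: "(cosh d)\<^sup>2 = (P + 1) / 2" "(sinh d)\<^sup>2 = (P - 1) / 2"
    by (simp_all add: P_def cosh_double cosh_square_eq)
  have Q: "(sin c)\<^sup>2 = (1 - Q) / 2" "(cos c)\<^sup>2 = (1 + Q) / 2"
    using sin_cos_squared_add[of c] unfolding Q_def cos_double by argo+
  have "(sin c)\<^sup>2 * (cosh d)\<^sup>2 = (cos a)\<^sup>2 * (sinh b)\<^sup>2"
    using arg_cong[OF re, of "\<lambda>t. t\<^sup>2"] by (simp add: power_mult_distrib)
  then have e1: "(1 - Q) / 2 * ((P + 1) / 2) = (1 - S) * (C - 1)"
    unfolding P Q by (simp add: S_def C_def cos_squared_eq sinh_square_eq)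
  have "(cos c)\<^sup>2 * (sinh d)\<^sup>2 = (sin a)\<^sup>2 * (cosh b)\<^sup>2"
    using arg_cong[OF im, of "\<lambda>t. t\<^sup>2"] by (simp add: power_mult_distrib)
  then have e2: "(1 + Q) / 2 * ((P - 1) / 2) = S * C"
    unfolding P Q by (simp add: S_def C_def)
  \<comment> \<open>The sum of \<open>e1\<close> and \<open>e2\<close>: the terms
    \<open>P * Q\<close> and \<open>S * C\<close> cancel.\<close>
  have diff: "(P - Q) / 2 = S + C - 1"
    using e1 e2 by (simp add: field_simps)
  \<comment> \<open>The difference of \<open>e2\<close> and \<open>e1\<close>. With the previous
    equation it yields the square of \<open>(P + Q) / 2\<close>, which is the radicand in
    \<open>H_plus\<close> and \<open>H_minus\<close>.\<close>
  have "P * Q = 4 * (S * C) - 2 * (S + C) + 3"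
    using e1 e2 by (simp add: field_simps)
  moreover have "((P + Q) / 2)\<^sup>2 = ((P - Q) / 2)\<^sup>2 + P * Q"
    by (simp add: power2_eq_square field_simps)
  ultimately have "((P + Q) / 2)\<^sup>2 = (S + C - 2)\<^sup>2 + 4 * S * C"
    unfolding diff by (simp add: power2_eq_square algebra_simps)
  moreover have "0 \<le> (P + Q) / 2"
  proof -
    have "1 \<le> P" "-1 \<le> Q"
      unfolding P_def Q_def by (rule cosh_real_ge_1, rule cos_ge_minus_one)
    then show ?thesis by simp
  qed
  ultimately have root: "sqrt ((S + C - 2)\<^sup>2 + 4 * S * C) = (P + Q) / 2"
    by (metis real_sqrt_unique)
  have S: "(cos (pi/2 + a))\<^sup>2 = S"
    by (simp add: S_def cos_add)
  \<comment> \<open>The two quantities are now \<open>(P + Q) / 2\<close> plus or minus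
    \<open>(P - Q) / 2\<close>.\<close>
  show "H_plus a b = cosh (2 * d)" "H_minus a b = cos (2 * c)"
    unfolding H_plus_def H_minus_def S C_def[symmetric] root diff[symmetric]
      P_def[symmetric] Q_def[symmetric]
    by (simp_all add: field_simps)
qed

text \<open>On the given interval \<open>sin c\<close> has the sign of \<open>c\<close>, while
  \<open>cosh d\<close> is positive. If \<open>cos a\<close> vanishes, then \<open>b = 0\<close> and
  both sides are zero; otherwise \<open>cos a\<close> is positive.\<close>

lemma sgn_of_sin_cosh:
  fixes a b c d :: real
  assumes "sin c * cosh d = - (cos a * sinh b)" "\<bar>c\<bar> \<le> pi/2"
    and "\<bar>a\<bar> < pi/2 \<or> \<bar>a\<bar> = pi/2 \<and> b = 0"
  shows "sgn c = - sgn b"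
proof -
  have "sgn c = sgn (sin c)"
    using assms(2) sin_gt_zero[of c] sin_gt_zero[of "- c"] pi_gt_zero
    by (cases c "0 :: real" rule: linorder_cases) (auto simp: abs_le_iff)
  also have "\<dots> = sgn (sin c * cosh d)"
    by (simp add: sgn_mult)
  also have "\<dots> = - (sgn (cos a) * sgn (sinh b))"
    unfolding assms(1) by (simp add: sgn_mult)
  also have "sgn (sinh b) = sgn b"
    by (simp add: sgn_if)
  also have "- (sgn (cos a) * sgn b) = - sgn b"
    using assms(3) cos_gt_zero_pi[of a] by (auto simp: abs_less_iff)
  finally show ?thesis .
qed

lemma sgn_of_cos_sinh:
  fixes a b c d :: real
  assumes "cos c * sinh d = sin a * cosh b" "\<bar>a\<bar> \<le> pi/2"
    and "\<bar>c\<bar> < pi/2 \<or> \<bar>c\<bar> = pi/2 \<and> d = 0"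
  shows "sgn d = sgn a"
  \<comment> \<open>The instantiation follows the order of occurrence \<open>c\<close>,
    \<open>d\<close>, \<open>a\<close>, \<open>b\<close>: the pair \<open>a\<close>,
    \<open>b\<close> replaces \<open>c\<close>, \<open>d\<close>, and \<open>c\<close>,
    \<open>- d\<close> replaces \<open>a\<close>, \<open>b\<close>. As \<open>sinh\<close> and
    \<open>sgn\<close> are odd, this turns one relation into the other.\<close>
  using sgn_of_sin_cosh[of a b c "- d"] assms by simp

theorem theorem1p4:
  fixes x y :: "'a::complex_normed_vector" and a b :: real
  assumes "x \<noteq> 0" and "y \<noteq> 0"
    and "complex_angle x y = complex_of_real (pi/2) + complex_of_real a + \<i> * complex_of_real b"
  shows "complex_angle x y \<in> angle_range
    \<and> - (pi/2) \<le> a \<and> a \<le> pi/2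
    \<and> (a = pi/2 \<or> a = - (pi/2) \<longrightarrow> b = 0)
    \<and> complex_angle (\<i> *\<^sub>C x) y =
        complex_of_real (pi/2) + 1/2 *
          (complex_of_real (- sgn b * arccos (H_minus a b))
           + \<i> * complex_of_real (sgn a * arcosh (H_plus a b)))"
proof -
  have mem: "complex_angle x y \<in> angle_range"
    using complex_angle_mem assms by blast
  then have ab: "\<bar>a\<bar> < pi/2 \<or> \<bar>a\<bar> = pi/2 \<and> b = 0"
    unfolding assms(3) shifted_mem_angle_range_iff .
  define c d where "c = Re (complex_angle (\<i> *\<^sub>C x) y) - pi/2"
    and "d = Im (complex_angle (\<i> *\<^sub>C x) y)"
  have ang: "complex_angle (\<i> *\<^sub>C x) y
      = complex_of_real (pi/2) + complex_of_real c + \<i> * complex_of_real d"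
    by (simp add: complex_eq_iff c_def d_def)
  have "\<i> *\<^sub>C x \<noteq> 0"
    using assms norm_scaleC_i[of x] by auto
  then have "complex_angle (\<i> *\<^sub>C x) y \<in> angle_range"
    using complex_angle_mem assms by blast
  then have cd: "\<bar>c\<bar> < pi/2 \<or> \<bar>c\<bar> = pi/2 \<and> d = 0"
    unfolding ang shifted_mem_angle_range_iff .
  have "Complex (sin c * cosh d) (cos c * sinh d) = \<i> * Complex (sin a * cosh b) (cos a * sinh b)"
    using cos_complex_angle_scaleC_i[OF assms(1,2)] unfolding ang assms(3) cos_shifted by simp
  then have eqs: "sin c * cosh d = - (cos a * sinh b)" "cos c * sinh d = sin a * cosh b"
    by (simp_all add: complex_eq_iff)
  have bounds: "\<bar>a\<bar> \<le> pi/2" "\<bar>c\<bar> \<le> pi/2"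
    using ab cd by auto
  \<comment> \<open>Both inverse functions see only even functions of \<open>c\<close> and
    \<open>d\<close>, so they return absolute values; \<open>2 * \<bar>c\<bar>\<close> lies in the
    range of \<open>arccos\<close> because \<open>\<bar>c\<bar> \<le> pi/2\<close>. The sign factors
    then restore \<open>2 * c\<close> and \<open>2 * d\<close>, also when these are zero.\<close>
  have "arccos (cos (2 * c)) = 2 * \<bar>c\<bar>"
    using bounds(2) arccos_cos[of "2 * \<bar>c\<bar>"] by (simp add: abs_if split: if_splits)
  moreover have "arcosh (cosh (2 * d)) = 2 * \<bar>d\<bar>"
    using arcosh_cosh_real[of "2 * \<bar>d\<bar>"] by (simp add: abs_if split: if_splits)
  moreover have "sgn c = - sgn b" "sgn d = sgn a"
    using sgn_of_sin_cosh[OF eqs(1) bounds(2) ab] sgn_of_cos_sinh[OF eqs(2) bounds(1) cd] .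
  moreover have "sgn c * (2 * \<bar>c\<bar>) = 2 * c" "sgn d * (2 * \<bar>d\<bar>) = 2 * d"
    by (simp_all add: sgn_if)
  ultimately have "- sgn b * arccos (H_minus a b) = 2 * c" "sgn a * arcosh (H_plus a b) = 2 * d"
    unfolding H_plus_eq_cosh[OF eqs] H_minus_eq_cos[OF eqs] by simp_all
  then have "complex_angle (\<i> *\<^sub>C x) y = complex_of_real (pi/2) + 1/2 *
      (complex_of_real (- sgn b * arccos (H_minus a b))
        + \<i> * complex_of_real (sgn a * arcosh (H_plus a b)))"
    by (simp only: ang) (simp add: algebra_simps)
  with mem ab bounds(1) show ?thesis by auto
qed

end
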